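(* Let $\alpha\in(0,1)$, let $J=[0,T]$ for some $T>0$ or $J=[0,\infty)$, and let $f:J\times\mathbb{R}\to\mathbb{R}$ be continuous and satisfy $|f(t,x)-f(t,y)|\le L(t)|x-y|$ for all $t\in J$, $x,y\in\mathbb{R}$, where $L:J\to[0,\infty)$ is continuous. Then for any two solutions $x_1(\cdot),x_2(\cdot)$ of ${}^{C}D^\alpha_{0+}x(t)=f(t,x(t))$ on $J$ and any $t\in J$, $$|x_2(t)-x_1(t)|\ \ge\ |x_2(0)-x_1(0)|\,E_\alpha\Big(-\big(\max_{0\le\tau\le t}L(\tau)\big)t^\alpha\Big).$$
   Context: ${}^{C}D^\alpha_{0+}$ is the Caputo fractional derivative of order $\alpha$; a solution is a continuous $x:J\to\mathbb{R}$ with $x(t)=x(0)+\frac{1}{\Gamma(\alpha)}\int_0^t(t-\tau)^{\alpha-1}f(\tau,x(\tau))\,d\tau$ for all $t\in J$. $E_\alpha(z)=\sum_{k=0}^\infty\frac{z^k}{\Gamma(\alpha k+1)}$ is the Mittag-Leffler function. *)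

theory Defs
  imports "HOL-Analysis.Analysis"
begin

definition mittag_leffler :: "real \<Rightarrow> real \<Rightarrow> real" where
  "mittag_leffler \<alpha> z = (\<Sum>k. z ^ k / Gamma (\<alpha> * real k + 1))"

text \<open>x is a solution of the Caputo equation D^alpha x = f(t,x) on J:
  x continuous on J and satisfies the Volterra integral equation (Lebesgue integral).\<close>
definition caputo_solution ::
  "real \<Rightarrow> (real \<Rightarrow> real \<Rightarrow> real) \<Rightarrow> real set \<Rightarrow> (real \<Rightarrow> real) \<Rightarrow> bool" where
  "caputo_solution \<alpha> f J x \<longleftrightarrow>
     continuous_on J x \<and>
     (\<forall>t\<in>J. x t = x 0 + (1 / Gamma \<alpha>) *
        (LINT \<tau>:{0..t}|lborel. (t - \<tau>) powr (\<alpha> - 1) * f \<tau> (x \<tau>)))"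

end

theory Submission
  imports Defs
begin

text \<open>
  Write \<open>k\<^sub>\<beta>(t) = t\<^bsup>\<beta>-1\<^esup> / \<Gamma>(\<beta>)\<close> and \<open>r\<^sub>\<beta> = \<Sum>n. (-M)\<^sup>n k\<close> with index \<open>\<alpha> n + \<beta>\<close> of \<open>k\<close>, so that
  \<open>r\<^sub>1(t) = E\<^sub>\<alpha>(-M t\<^sup>\<alpha>)\<close> and, with \<open>*\<close> denoting convolution, \<open>r\<^sub>\<beta> + M k\<^sub>\<alpha> * r\<^sub>\<beta> = k\<^sub>\<beta>\<close>. The difference of two
  solutions satisfies \<open>u = u(0) + k\<^sub>\<alpha> * g\<close> with \<open>|g| \<le> M |u|\<close>, hence
  \<open>u = u(0) r\<^sub>1 + r\<^sub>\<alpha> * (g + M u)\<close>. Both \<open>r\<^sub>1\<close> and \<open>r\<^sub>\<alpha>\<close> are positive, because \<open>k\<^sub>\<alpha>\<close> is decreasing and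
  log-convex. If \<open>u(0) > 0\<close>, then \<open>g + M u \<ge> 0\<close> as long as \<open>u \<ge> 0\<close>, so \<open>u \<ge> u(0) r\<^sub>1 > 0\<close> up to the first
  zero of \<open>u\<close>; therefore there is no zero and the bound holds throughout.
\<close>

subsection \<open>Riemann-Liouville and Mittag-Leffler kernels\<close>

text \<open>The value 0 for \<open>t \<le> 0\<close> turns convolution over \<open>[0, t]\<close>
  into an integral over the whole line, so no range has to be carried along.\<close>

definition rl_kernel :: "real \<Rightarrow> real \<Rightarrow> real" where
  "rl_kernel \<beta> t = (if 0 < t then t powr (\<beta> - 1) / Gamma \<beta> else 0)"

text \<open>For \<open>t > 0\<close> this is \<open>t\<^bsup>\<beta>-1\<^esup> E\<close> with the two-parameter Mittag-Leffler function \<open>E\<close> of indices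
  \<open>\<alpha>, \<beta>\<close> taken at \<open>\<mu> t\<^sup>\<alpha>\<close>.\<close>

definition ml_kernel :: "real \<Rightarrow> real \<Rightarrow> real \<Rightarrow> real \<Rightarrow> real" where
  "ml_kernel \<mu> \<alpha> \<beta> t = (\<Sum>n. \<mu> ^ n * rl_kernel (\<alpha> * real n + \<beta>) t)"

lemma rl_kernel_measurable [measurable]: "rl_kernel \<beta> \<in> borel_measurable borel"
  unfolding rl_kernel_def [abs_def] by measurable

lemma rl_kernel_nonneg: "0 < \<beta> \<Longrightarrow> 0 \<le> rl_kernel \<beta> t"
  by (simp add: rl_kernel_def less_imp_le)

lemma ml_kernel_measurable [measurable]: "ml_kernel \<mu> \<alpha> \<beta> \<in> borel_measurable borel"
  unfolding ml_kernel_def [abs_def] by measurable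

lemma ml_kernel_nonpos_arg: "t \<le> 0 \<Longrightarrow> ml_kernel \<mu> \<alpha> \<beta> t = 0"
  by (simp add: ml_kernel_def rl_kernel_def)

text \<open>The Beta integral after the substitution \<open>s = t * x\<close>; this is the semigroup
  law of fractional integration.\<close>

lemma rl_kernel_convolution:
  assumes "0 < \<beta>" "0 < \<gamma>"
  shows "has_bochner_integral lborel (\<lambda>s. rl_kernel \<beta> (t - s) * rl_kernel \<gamma> s)
    (rl_kernel (\<beta> + \<gamma>) t)"
proof (cases "0 < t")
  case False
  then have "(\<lambda>s. rl_kernel \<beta> (t - s) * rl_kernel \<gamma> s) = (\<lambda>_. 0)"
    by (auto simp: rl_kernel_def fun_eq_iff)
  with False show ?thesis by (simp add: rl_kernel_def has_bochner_integral_zero)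
next
  case True
  let ?F = "\<lambda>s. rl_kernel \<beta> (t - s) * rl_kernel \<gamma> s"
  let ?c = "t powr (\<beta> + \<gamma> - 2) / (Gamma \<beta> * Gamma \<gamma>)"
  define b where "b x = indicator {0..1} x *\<^sub>R (x powr (\<gamma> - 1) * (1 - x) powr (\<beta> - 1))" for x :: real
  have "set_integrable lborel {0..1} (\<lambda>x. x powr (\<gamma> - 1) * (1 - x) powr (\<beta> - 1))"
    by (rule integrable_Beta) (use assms in auto)
  from this set_borel_integral_eq_integral(2)[OF this]
  have "has_bochner_integral lborel b (Beta \<gamma> \<beta>)"
    using has_integral_Beta_real[OF \<open>0 < \<gamma>\<close> \<open>0 < \<beta>\<close>]
    by (simp add: has_bochner_integral_iff set_integrable_def set_lebesgue_integral_def b_def [abs_def]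
        integral_unique)
  then have "has_bochner_integral lborel (\<lambda>x. ?c * b x) (?c * Beta \<gamma> \<beta>)"
    by (rule has_bochner_integral_mult_right)
  also have "(\<lambda>x. ?c * b x) = (\<lambda>x. ?F (0 + t * x))"
  proof
    fix x :: real
    show "?c * b x = ?F (0 + t * x)"
    proof (cases "0 < x \<and> x < 1")
      case inner: True
      have "t - t * x = t * (1 - x)" by (simp add: algebra_simps)
      moreover have "t powr (\<beta> + \<gamma> - 2) = t powr (\<beta> - 1) * t powr (\<gamma> - 1)"
        by (simp flip: powr_add add: algebra_simps)
      ultimately show ?thesis
        using inner True by (simp add: b_def rl_kernel_def powr_mult)
    next
      case False
      \<comment> \<open>Both sides vanish here; at the endpoints \<open>b\<close> does so because
        \<open>0 powr a = 0\<close>.\<close>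
      have "0 < t - t * x \<longleftrightarrow> x < 1" "0 < t * x \<longleftrightarrow> 0 < x"
        using True by (auto simp: zero_less_mult_iff)
      with False show ?thesis
        by (auto simp: b_def rl_kernel_def indicator_def)
    qed
  qed
  \<comment> \<open>The division by \<open>\<bar>t\<bar>\<close> is the Jacobian of the
    substitution; it lowers the exponent \<open>\<beta> + \<gamma> - 1\<close> to the one in
    \<open>?c\<close>.\<close>
  also have "?c * Beta \<gamma> \<beta> = rl_kernel (\<beta> + \<gamma>) t /\<^sub>R \<bar>t\<bar>"
  proof -
    have "t powr (\<beta> + \<gamma> - 1) = t * t powr (\<beta> + \<gamma> - 2)"
      using powr_mult_base[of t "\<beta> + \<gamma> - 2"] True by simp
    moreover have "Gamma \<beta> \<noteq> 0" "Gamma \<gamma> \<noteq> 0"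
      using Gamma_real_pos[OF assms(1)] Gamma_real_pos[OF assms(2)] by simp_all
    ultimately show ?thesis
      using True by (simp add: rl_kernel_def Beta_def field_simps add.commute)
  qed
  finally show ?thesis
    using True by (subst lborel_has_bochner_integral_real_affine_iff[of t _ _ 0]) auto
qed

text \<open>Log-convexity: the slope of \<open>ln \<circ> Gamma\<close> on \<open>[x, x + a]\<close> is at least the one on \<open>[x - 1, x]\<close>, namely \<open>ln (x - 1)\<close>.\<close>

lemma Gamma_add_ge:
  fixes x a :: real
  assumes "1 < x" "0 < a"
  shows "Gamma x * (x - 1) powr a \<le> Gamma (x + a)"
proof -
  let ?f = "ln \<circ> Gamma :: real \<Rightarrow> real"
  have "(?f (x - 1) - ?f x) / (x - 1 - x) \<le> (?f (x - 1) - ?f (x + a)) / (x - 1 - (x + a))"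
    and "(?f (x - 1) - ?f (x + a)) / (x - 1 - (x + a)) \<le> (?f x - ?f (x + a)) / (x - (x + a))"
    by (rule convex_on_slope_le[OF log_convex_Gamma_real]; use assms in simp)+
  then have slope: "?f x - ?f (x - 1) \<le> (?f (x + a) - ?f x) / a"
    using assms by (simp add: field_simps)
  have "Gamma x = (x - 1) * Gamma (x - 1)"
    using Gamma_plus1[of "x - 1"] assms nonpos_Ints_nonpos[of "x - 1"] by force
  then have "?f x - ?f (x - 1) = ln (x - 1)"
    using assms less_imp_neq[OF Gamma_real_pos[of "x - 1"]] by (simp add: ln_mult)
  with slope have "ln (Gamma x) + a * ln (x - 1) \<le> ln (Gamma (x + a))"
    using assms by (simp add: field_simps)
  then have "ln (Gamma x * (x - 1) powr a) \<le> ln (Gamma (x + a))"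
    using assms less_imp_neq[OF Gamma_real_pos[of x]] by (simp add: ln_mult ln_powr)
  then show ?thesis
    using assms by (subst (asm) ln_le_cancel_iff) auto
qed

text \<open>Ratio test: by \<open>Gamma_add_ge\<close> with \<open>a = \<alpha>\<close>, consecutive
  terms have quotient at most
  \<open>\<bar>z\<bar> / (\<alpha> * n + \<beta> - 1) powr \<alpha>\<close> in absolute value, which
  tends to 0.\<close>

lemma summable_mittag_leffler:
  fixes z \<alpha> \<beta> :: real
  assumes "0 < \<alpha>" "0 < \<beta>"
  shows "summable (\<lambda>n. z ^ n / Gamma (\<alpha> * real n + \<beta>))"
proof -
  \<comment> \<open>Once \<open>\<alpha> * n + \<beta> - 1\<close> exceeds \<open>C\<close>, the
    quotient is at most 1/2; the summand 1 keeps \<open>C\<close> positive for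
    \<open>z = 0\<close>.\<close>
  define C where "C = (2 * \<bar>z\<bar> + 1) powr (1 / \<alpha>)"
  have C: "0 < C" "C powr \<alpha> = 2 * \<bar>z\<bar> + 1"
    using assms by (simp_all add: C_def powr_powr)
  have "eventually (\<lambda>n. (C + 1) / \<alpha> \<le> real n) sequentially"
    using filterlim_real_sequentially by (simp add: filterlim_at_top)
  then have ev: "eventually (\<lambda>n. C \<le> \<alpha> * real n + \<beta> - 1) sequentially"
  proof eventually_elim
    case (elim n)
    then have "C + 1 \<le> \<alpha> * real n"
      using assms by (simp add: field_simps)
    then show ?case using assms by simp
  qed
  then have "eventually (\<lambda>n. 2 * \<bar>z\<bar> \<le> (\<alpha> * real n + \<beta> - 1) powr \<alpha>) sequentially"
  proof eventually_elim
    case (elim n)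
    then have "C powr \<alpha> \<le> (\<alpha> * real n + \<beta> - 1) powr \<alpha>"
      using C assms by (intro powr_mono2) auto
    then show ?case using C by simp
  qed
  moreover have "eventually (\<lambda>n. 1 < \<alpha> * real n + \<beta>) sequentially"
    using ev by eventually_elim (use C in simp)
  ultimately have "eventually (\<lambda>n. norm (z ^ Suc n / Gamma (\<alpha> * real (Suc n) + \<beta>))
      \<le> 1/2 * norm (z ^ n / Gamma (\<alpha> * real n + \<beta>))) sequentially"
  proof eventually_elim
    case (elim n)
    let ?x = "\<alpha> * real n + \<beta>"
    have G: "0 < Gamma ?x" "0 < Gamma (?x + \<alpha>)"
      using elim assms by auto
    have "Gamma ?x * (2 * \<bar>z\<bar>) \<le> Gamma ?x * (?x - 1) powr \<alpha>"
      by (rule mult_left_mono) (use elim G in auto)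
    also have "\<dots> \<le> Gamma (?x + \<alpha>)"
      by (rule Gamma_add_ge) (use elim assms in auto)
    finally have le: "2 * \<bar>z\<bar> * Gamma ?x \<le> Gamma (?x + \<alpha>)"
      by (simp add: mult_ac)
    have "2 * (\<bar>z\<bar> * \<bar>z\<bar> ^ n) * Gamma ?x = (2 * \<bar>z\<bar> * Gamma ?x) * \<bar>z\<bar> ^ n"
      by simp
    also have "\<dots> \<le> Gamma (?x + \<alpha>) * \<bar>z\<bar> ^ n"
      by (rule mult_right_mono[OF le]) simp
    finally have "2 * (\<bar>z\<bar> * \<bar>z\<bar> ^ n) * Gamma ?x \<le> Gamma (?x + \<alpha>) * \<bar>z\<bar> ^ n" .
    moreover have "\<alpha> * real (Suc n) + \<beta> = ?x + \<alpha>"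
      by (simp add: algebra_simps)
    ultimately show ?case
      using G by (simp add: abs_mult power_abs field_simps)
  qed
  then obtain N where "\<And>n. n \<ge> N \<Longrightarrow> norm (z ^ Suc n / Gamma (\<alpha> * real (Suc n) + \<beta>))
      \<le> 1/2 * norm (z ^ n / Gamma (\<alpha> * real n + \<beta>))"
    by (auto simp: eventually_sequentially)
  then show ?thesis
    by (intro summable_ratio_test[of "1/2" N]) auto
qed

lemma ml_kernel_term:
  assumes "0 < t"
  shows "\<mu> ^ n * rl_kernel (\<alpha> * real n + \<beta>) t =
    t powr (\<beta> - 1) * ((\<mu> * t powr \<alpha>) ^ n / Gamma (\<alpha> * real n + \<beta>))"
proof -
  have "t powr (\<alpha> * real n + \<beta> - 1) = t powr (\<beta> - 1) * t powr (\<alpha> * real n)"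
    by (simp flip: powr_add add: algebra_simps)
  also have "t powr (\<alpha> * real n) = (t powr \<alpha>) ^ n"
    using assms by (simp add: powr_powr flip: powr_realpow)
  finally show ?thesis
    using assms by (simp add: rl_kernel_def power_mult_distrib)
qed

lemma summable_ml_kernel:
  assumes "0 < \<alpha>" "0 < \<beta>"
  shows "summable (\<lambda>n. \<mu> ^ n * rl_kernel (\<alpha> * real n + \<beta>) t)"
proof (cases "0 < t")
  case True
  then show ?thesis
    unfolding ml_kernel_term[OF True]
    by (intro summable_mult summable_mittag_leffler assms)
qed (simp add: rl_kernel_def)

lemma ml_kernel_eq:
  assumes "0 < t" "0 < \<alpha>" "0 < \<beta>"
  shows "ml_kernel \<mu> \<alpha> \<beta> t =
    t powr (\<beta> - 1) * (\<Sum>n. (\<mu> * t powr \<alpha>) ^ n / Gamma (\<alpha> * real n + \<beta>))"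
  unfolding ml_kernel_def ml_kernel_term[OF \<open>0 < t\<close>]
  by (intro suminf_mult summable_mittag_leffler assms)

text \<open>Splits off the term \<open>n = 0\<close>. Since convolution with
  \<open>rl_kernel \<alpha>\<close> raises the index by \<open>\<alpha>\<close>, this is the
  Volterra equation of the kernel.\<close>

lemma ml_kernel_unfold:
  assumes "0 < \<alpha>" "0 < \<beta>"
  shows "ml_kernel \<mu> \<alpha> \<beta> t = rl_kernel \<beta> t + \<mu> * ml_kernel \<mu> \<alpha> (\<beta> + \<alpha>) t"
proof -
  have "summable (\<lambda>n. \<mu> ^ n * rl_kernel (\<alpha> * real n + (\<beta> + \<alpha>)) t)"
    using assms by (intro summable_ml_kernel) auto
  then have "\<mu> * ml_kernel \<mu> \<alpha> (\<beta> + \<alpha>) t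
      = (\<Sum>n. \<mu> ^ Suc n * rl_kernel (\<alpha> * real (Suc n) + \<beta>) t)"
    unfolding ml_kernel_def
    by (subst suminf_mult[symmetric]) (simp_all add: algebra_simps)
  then show ?thesis
    using suminf_split_head[OF summable_ml_kernel[OF assms, of \<mu> t]]
    by (simp add: ml_kernel_def)
qed

text \<open>Termwise, convolution adds \<open>\<gamma>\<close> to the index. Sum and integral may be
  exchanged because the norms give the same series with \<open>\<bar>\<mu>\<bar>\<close> for
  \<open>\<mu>\<close>, which again converges.\<close>

lemma rl_ml_kernel_convolution:
  assumes "0 < \<alpha>" "0 < \<beta>" "0 < \<gamma>"
  shows "has_bochner_integral lborel (\<lambda>s. rl_kernel \<gamma> (t - s) * ml_kernel \<mu> \<alpha> \<beta> s)
    (ml_kernel \<mu> \<alpha> (\<beta> + \<gamma>) t)"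
proof -
  define F where "F n s = rl_kernel \<gamma> (t - s) * (\<mu> ^ n * rl_kernel (\<alpha> * real n + \<beta>) s)" for n s
  have pos: "0 < \<alpha> * real n + \<beta>" for n
    using assms by (simp add: add_nonneg_pos)
  have conv: "has_bochner_integral lborel
      (\<lambda>s. c ^ n * (rl_kernel \<gamma> (t - s) * rl_kernel (\<alpha> * real n + \<beta>) s))
      (c ^ n * rl_kernel (\<alpha> * real n + (\<beta> + \<gamma>)) t)" for c n
    using has_bochner_integral_mult_right[OF rl_kernel_convolution[OF \<open>0 < \<gamma>\<close> pos[of n]]]
    by (simp add: add_ac)
  have F: "has_bochner_integral lborel (F n) (\<mu> ^ n * rl_kernel (\<alpha> * real n + (\<beta> + \<gamma>)) t)" for n
    using conv[of \<mu> n] by (simp add: F_def [abs_def] mult_ac)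
  have "norm (F n s) = \<bar>\<mu>\<bar> ^ n * (rl_kernel \<gamma> (t - s) * rl_kernel (\<alpha> * real n + \<beta>) s)" for n s
    using assms pos[of n] by (simp add: F_def abs_mult power_abs rl_kernel_nonneg)
  then have nF: "has_bochner_integral lborel (\<lambda>s. norm (F n s))
      (\<bar>\<mu>\<bar> ^ n * rl_kernel (\<alpha> * real n + (\<beta> + \<gamma>)) t)"
    and nF': "norm (F n s) = rl_kernel \<gamma> (t - s) * (\<bar>\<mu>\<bar> ^ n * rl_kernel (\<alpha> * real n + \<beta>) s)" for n s
    using conv[of "\<bar>\<mu>\<bar>" n] by (simp_all add: mult_ac)
  have 1: "integrable lborel (F n)" for n
    using F by (simp add: has_bochner_integral_iff)
  have 2: "AE s in lborel. summable (\<lambda>n. norm (F n s))"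
    unfolding nF' by (intro AE_I2 summable_mult summable_ml_kernel assms)
  have 3: "summable (\<lambda>n. \<integral>s. norm (F n s) \<partial>lborel)"
    using nF summable_ml_kernel[of \<alpha> "\<beta> + \<gamma>" "\<bar>\<mu>\<bar>" t] assms
    by (simp add: has_bochner_integral_iff)
  have "(\<lambda>s. \<Sum>n. F n s) = (\<lambda>s. rl_kernel \<gamma> (t - s) * ml_kernel \<mu> \<alpha> \<beta> s)"
    unfolding F_def ml_kernel_def by (intro ext suminf_mult summable_ml_kernel assms)
  moreover have "(\<Sum>n. \<integral>s. F n s \<partial>lborel) = ml_kernel \<mu> \<alpha> (\<beta> + \<gamma>) t"
    using F by (simp add: has_bochner_integral_iff ml_kernel_def)
  ultimately show ?thesis
    using integrable_suminf[OF 1 2 3] integral_suminf[OF 1 2 3]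
    by (simp add: has_bochner_integral_iff)
qed

lemma mittag_leffler_eq_ml_kernel:
  assumes "0 < t" "0 < \<alpha>"
  shows "mittag_leffler \<alpha> (\<mu> * t powr \<alpha>) = ml_kernel \<mu> \<alpha> 1 t"
  using assms by (simp add: ml_kernel_eq mittag_leffler_def)

subsection \<open>Positivity of the Mittag-Leffler kernels\<close>

lemma isCont_mittag_leffler_series:
  fixes \<alpha> \<beta> :: real
  assumes "0 < \<alpha>" "0 < \<beta>"
  shows "isCont (\<lambda>z. \<Sum>n. z ^ n / Gamma (\<alpha> * real n + \<beta>)) z"
proof -
  have "isCont (\<lambda>z. \<Sum>n. inverse (Gamma (\<alpha> * real n + \<beta>)) * z ^ n) z"
    by (rule isCont_powser_converges_everywhere)
       (use summable_mittag_leffler[OF assms] in \<open>simp add: field_simps\<close>)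
  then show ?thesis by (simp add: field_simps)
qed

lemma continuous_on_ml_kernel:
  assumes "0 < \<alpha>" "0 < \<beta>"
  shows "continuous_on {0<..} (ml_kernel \<mu> \<alpha> \<beta>)"
proof -
  have "continuous_on UNIV (\<lambda>z. \<Sum>n. z ^ n / Gamma (\<alpha> * real n + \<beta>))"
    using isCont_mittag_leffler_series[OF assms] by (simp add: continuous_at_imp_continuous_on)
  then have "continuous_on {0<..} (\<lambda>t. \<Sum>n. (\<mu> * t powr \<alpha>) ^ n / Gamma (\<alpha> * real n + \<beta>))"
    by (rule continuous_on_compose2) (auto intro!: continuous_intros)
  then have "continuous_on {0<..}
      (\<lambda>t. t powr (\<beta> - 1) * (\<Sum>n. (\<mu> * t powr \<alpha>) ^ n / Gamma (\<alpha> * real n + \<beta>)))"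
    by (intro continuous_on_mult) (auto intro!: continuous_intros)
  then show ?thesis
    by (rule continuous_on_cong[THEN iffD1, rotated 2]) (use assms in \<open>auto simp: ml_kernel_eq\<close>)
qed

text \<open>The prefactor \<open>t powr (\<beta> - 1)\<close> is positive and the series tends to
  its constant term \<open>1 / Gamma \<beta>\<close>.\<close>

lemma ml_kernel_eventually_pos:
  assumes "0 < \<alpha>" "0 < \<beta>"
  shows "eventually (\<lambda>t. 0 < ml_kernel \<mu> \<alpha> \<beta> t) (at_right 0)"
proof -
  let ?E = "\<lambda>z. \<Sum>n. z ^ n / Gamma (\<alpha> * real n + \<beta>)"
  have "((\<lambda>t. t powr \<alpha>) \<longlongrightarrow> 0 powr \<alpha>) (at_right 0)"
    using assms by (intro tendsto_powr' tendsto_intros) (auto simp: eventually_at_filter)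
  then have "((\<lambda>t. \<mu> * t powr \<alpha>) \<longlongrightarrow> \<mu> * 0) (at_right 0)"
    by (intro tendsto_mult tendsto_const) simp
  then have "((\<lambda>t. ?E (\<mu> * t powr \<alpha>)) \<longlongrightarrow> ?E 0) (at_right 0)"
    by (intro isCont_tendsto_compose[OF isCont_mittag_leffler_series[OF assms]]) simp
  moreover have "?E 0 = 1 / Gamma \<beta>"
    using powser_zero[of "\<lambda>n. inverse (Gamma (\<alpha> * real n + \<beta>))"] by (simp add: field_simps)
  ultimately have "eventually (\<lambda>t. 0 < ?E (\<mu> * t powr \<alpha>)) (at_right 0)"
    using assms by (intro order_tendstoD(1)[of _ "1 / Gamma \<beta>"]) simp_all
  moreover have "eventually (\<lambda>t. 0 < (t::real)) (at_right 0)"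
    by (simp add: eventually_at_filter)
  ultimately show ?thesis
    by eventually_elim (use assms in \<open>simp add: ml_kernel_eq\<close>)
qed

text \<open>The quotient of the two kernels is largest at \<open>s = 0\<close>: stretching
  \<open>r - s\<close> by \<open>t / r\<close> gives at most \<open>t - s\<close>, and the exponent
  \<open>\<alpha> - 1 \<le> 0\<close> reverses the inequality.\<close>

lemma rl_kernel_translate_le:
  assumes "0 < \<alpha>" "\<alpha> \<le> 1" "0 \<le> s" "s < r" "r < t"
  shows "rl_kernel \<alpha> (t - s) \<le> (t / r) powr (\<alpha> - 1) * rl_kernel \<alpha> (r - s)"
proof -
  have "t / r * (r - s) \<le> t - s"
  proof -
    have "t / r * (r - s) = t - t / r * s" using assms by (simp add: field_simps)
    moreover have "1 * s \<le> t / r * s" using assms by (intro mult_right_mono) auto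
    ultimately show ?thesis by simp
  qed
  then have "(t - s) powr (\<alpha> - 1) \<le> (t / r * (r - s)) powr (\<alpha> - 1)"
    using assms by (intro powr_mono2') auto
  also have "\<dots> = (t / r) powr (\<alpha> - 1) * (r - s) powr (\<alpha> - 1)"
    using assms by (intro powr_mult)
  finally show ?thesis
    using assms by (simp add: rl_kernel_def divide_right_mono less_imp_le)
qed

text \<open>At a first zero \<open>t0\<close> of \<open>y\<close>, compare the Volterra equation of \<open>y\<close> at \<open>t0\<close> with the one at a point
  \<open>r\<close> maximising \<open>y\<close> on a short interval to the left of \<open>t0\<close>: by log-convexity of the kernel, the
  memory of \<open>[0, r]\<close> leaves room for \<open>q * y r\<close> with \<open>q \<ge> 1/2\<close>, while the remaining interval contributes
  less than \<open>y r / 2\<close>.\<close>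

theorem ml_kernel_pos:
  assumes \<alpha>: "0 < \<alpha>" "\<alpha> \<le> 1" and \<beta>: "\<alpha> \<le> \<beta>" and M: "0 \<le> M" and x: "0 < x"
  shows "0 < ml_kernel (- M) \<alpha> \<beta> x"
proof (rule ccontr)
  define y where "y = ml_kernel (- M) \<alpha> \<beta>"
  assume "\<not> 0 < ml_kernel (- M) \<alpha> \<beta> x"
  then have yx: "y x \<le> 0" by (simp add: y_def)
  have \<beta>0: "0 < \<beta>" using \<alpha> \<beta> by simp
  have cont: "continuous_on {0<..} y"
    unfolding y_def by (rule continuous_on_ml_kernel) (use \<alpha> \<beta>0 in auto)
  obtain d where d: "0 < d" "\<And>t. 0 < t \<Longrightarrow> t < d \<Longrightarrow> 0 < y t"
    using ml_kernel_eventually_pos[OF \<open>0 < \<alpha>\<close> \<beta>0, of "- M"]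
    by (auto simp: eventually_at_right_field y_def)
  \<comment> \<open>Starting at \<open>d/2\<close> keeps the interval inside \<open>{0<..}\<close>,
    where \<open>y\<close> is continuous, and loses no zero because \<open>y\<close> is positive on
    \<open>(0, d)\<close>.\<close>
  let ?Z = "{t \<in> {d/2..x}. y t \<le> 0}"
  have "d \<le> x" using yx d(2)[of x] x by linarith
  then have "x \<in> ?Z" using yx d(1) by simp
  moreover have "compact ?Z"
  proof -
    have "closed ({d/2..x} \<inter> y -` {..0})"
      by (intro continuous_closed_preimage continuous_on_subset[OF cont]) (use d in auto)
    also have "{d/2..x} \<inter> y -` {..0} = ?Z" by auto
    finally have "closed ?Z" .
    moreover have "bounded ?Z"
      by (rule bounded_subset[OF bounded_closed_interval[of "d/2" x]]) auto
    ultimately show ?thesis by (simp add: compact_eq_bounded_closed)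
  qed
  ultimately obtain t0 where t0: "t0 \<in> ?Z" and least: "\<And>t. t \<in> ?Z \<Longrightarrow> t0 \<le> t"
    using compact_attains_inf[of ?Z] by blast
  have t0pos: "0 < t0" using t0 d by auto
  have before: "0 < y s" if "0 < s" "s < t0" for s
  proof (cases "s < d")
    case False
    then show ?thesis using least[of s] t0 that d by force
  qed (use d that in auto)
  have vol: "has_bochner_integral lborel (\<lambda>s. rl_kernel \<alpha> (t - s) * y s)
      (ml_kernel (- M) \<alpha> (\<beta> + \<alpha>) t)" for t
    unfolding y_def by (rule rl_ml_kernel_convolution) (use \<alpha> \<beta>0 in auto)
  define I where "I t = (\<integral>s. rl_kernel \<alpha> (t - s) * y s \<partial>lborel)" for t
  have int: "integrable lborel (\<lambda>s. rl_kernel \<alpha> (t - s) * y s)" for t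
    using vol by (simp add: has_bochner_integral_iff)
  have eq: "y t + M * I t = rl_kernel \<beta> t" for t
    using vol[of t] ml_kernel_unfold[OF \<open>0 < \<alpha>\<close> \<beta>0, of "- M" t]
    by (simp add: has_bochner_integral_iff I_def y_def)

  \<comment> \<open>\<open>rl_kernel (\<alpha> + 1) h\<close> is the mass of the kernel on an
    interval of length \<open>h\<close>, that is, the weight of the most recent memory.\<close>
  have "((\<lambda>h. M * rl_kernel (\<alpha> + 1) h) \<longlongrightarrow> M * 0) (at_right 0)"
  proof (intro tendsto_mult tendsto_const)
    have "((\<lambda>h. h powr \<alpha> / Gamma (\<alpha> + 1)) \<longlongrightarrow> 0 powr \<alpha> / Gamma (\<alpha> + 1)) (at_right 0)"
      using \<alpha> less_imp_neq[OF Gamma_real_pos[of "\<alpha> + 1"]]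
      by (intro tendsto_divide tendsto_powr' tendsto_intros) (auto simp: eventually_at_filter)
    moreover have "eventually (\<lambda>h. h powr \<alpha> / Gamma (\<alpha> + 1) = rl_kernel (\<alpha> + 1) h) (at_right 0)"
      by (auto simp: eventually_at_filter rl_kernel_def)
    ultimately show "(rl_kernel (\<alpha> + 1) \<longlongrightarrow> 0) (at_right 0)"
      using tendsto_cong by fastforce
  qed
  then have "eventually (\<lambda>h. M * rl_kernel (\<alpha> + 1) h < 1/2) (at_right 0)"
    by (rule order_tendstoD) simp
  then obtain e where e: "0 < e" "\<And>h. 0 < h \<Longrightarrow> h < e \<Longrightarrow> M * rl_kernel (\<alpha> + 1) h < 1/2"
    by (auto simp: eventually_at_right_field)
  \<comment> \<open>Close enough to \<open>t0\<close> for the choice of \<open>e\<close>, and at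
    least \<open>t0 / 2\<close>, so that \<open>t0 / r \<le> 2\<close> and hence
    \<open>q \<ge> 1/2\<close>.\<close>
  define a where "a = t0 - min (e/2) (t0/2)"
  have a: "0 < a" "t0 / 2 \<le> a" "a < t0" "t0 - a < e"
    using e t0pos by (auto simp: a_def min_def)
  obtain r where r: "r \<in> {a..t0}" and rmax: "\<And>s. s \<in> {a..t0} \<Longrightarrow> y s \<le> y r"
    using continuous_attains_sup[of "{a..t0}" y] continuous_on_subset[OF cont, of "{a..t0}"] a
    by fastforce
  \<comment> \<open>Positivity at \<open>a\<close> carries over to the maximum, so the maximiser is
    not \<open>t0\<close>.\<close>
  have "0 < y r" using rmax[of a] before[of a] a by auto
  then have r': "a \<le> r" "r < t0" "0 < r" using r t0 a by (auto simp: less_le)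

  define q where "q = (t0 / r) powr (\<alpha> - 1)"
  have q_half: "1/2 \<le> q"
  proof -
    have "t0 / r \<le> 2" using a r' by (simp add: field_simps)
    then have "2 powr (\<alpha> - 1) \<le> q"
      unfolding q_def using t0pos r' \<alpha> by (intro powr_mono2') auto
    moreover have "2 powr (- 1) \<le> (2::real) powr (\<alpha> - 1)" using \<alpha> by (intro powr_mono) auto
    ultimately show ?thesis by (simp add: powr_minus_divide)
  qed
  \<comment> \<open>Here \<open>\<alpha> \<le> \<beta>\<close> enters: the forcing term shrinks from
    \<open>r\<close> to \<open>t0\<close> by no more than the factor \<open>q\<close> of the
    kernel.\<close>
  have q_rl: "q * rl_kernel \<beta> r \<le> rl_kernel \<beta> t0"
  proof -
    have "q \<le> (t0 / r) powr (\<beta> - 1)"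
      unfolding q_def using r' \<beta> by (intro powr_mono) auto
    then have "q * r powr (\<beta> - 1) \<le> (t0 / r) powr (\<beta> - 1) * r powr (\<beta> - 1)"
      by (rule mult_right_mono) simp
    also have "\<dots> = t0 powr (\<beta> - 1)"
      using r' t0pos by (simp flip: powr_mult)
    finally show ?thesis
      using r' t0pos \<beta>0 by (simp add: rl_kernel_def divide_right_mono less_imp_le)
  qed

  \<comment> \<open>\<open>rl_kernel 1 (s - r)\<close> is the indicator of
    \<open>s > r\<close>.\<close>
  have tail: "has_bochner_integral lborel (\<lambda>s. rl_kernel \<alpha> (t0 - s) * rl_kernel 1 (s - r))
      (rl_kernel (\<alpha> + 1) (t0 - r))"
    using rl_kernel_convolution[OF \<open>0 < \<alpha>\<close>, of 1 "t0 - r"]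
    by (subst lborel_has_bochner_integral_real_affine_iff[of 1 _ _ r]) (auto simp: algebra_simps)
  have "I t0 \<le> (\<integral>s. q * (rl_kernel \<alpha> (r - s) * y s)
      + y r * (rl_kernel \<alpha> (t0 - s) * rl_kernel 1 (s - r)) \<partial>lborel)"
    unfolding I_def
  proof (rule integral_mono_AE)
    show "integrable lborel (\<lambda>s. rl_kernel \<alpha> (t0 - s) * y s)" by (rule int)
    show "integrable lborel (\<lambda>s. q * (rl_kernel \<alpha> (r - s) * y s)
        + y r * (rl_kernel \<alpha> (t0 - s) * rl_kernel 1 (s - r)))"
      using int tail by (simp add: has_bochner_integral_iff)
    show "AE s in lborel. rl_kernel \<alpha> (t0 - s) * y s \<le> q * (rl_kernel \<alpha> (r - s) * y s)
        + y r * (rl_kernel \<alpha> (t0 - s) * rl_kernel 1 (s - r))"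
      \<comment> \<open>At \<open>s = r\<close> both terms on the right are 0 while the left side is
        positive, so this point is discarded.\<close>
      using AE_lborel_singleton[of r]
    proof eventually_elim
      case (elim s)
      consider "s \<le> 0" | "0 < s" "s < r" | "r < s" "s < t0" | "t0 \<le> s"
        using elim by linarith
      then show ?case
      proof cases
        case 1
        then have "y s = 0" by (simp add: y_def ml_kernel_nonpos_arg)
        then show ?thesis
          using \<open>0 < y r\<close> \<alpha> by (simp add: rl_kernel_nonneg)
      next
        case 2
        have "rl_kernel \<alpha> (t0 - s) * y s \<le> q * rl_kernel \<alpha> (r - s) * y s"
          unfolding q_def using 2 r' before[of s] \<alpha>
          by (intro mult_right_mono rl_kernel_translate_le) auto
        with 2 show ?thesis by (simp add: rl_kernel_def mult_ac)
      next
        case 3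
        then have "rl_kernel \<alpha> (t0 - s) * y s \<le> rl_kernel \<alpha> (t0 - s) * y r"
          using \<alpha> r' by (intro mult_left_mono rl_kernel_nonneg rmax) auto
        with 3 show ?thesis by (simp add: rl_kernel_def mult_ac)
      next
        case 4
        then show ?thesis using r' by (simp add: rl_kernel_def)
      qed
    qed
  qed
  also have "\<dots> = q * I r + y r * rl_kernel (\<alpha> + 1) (t0 - r)"
    using int[of r] tail by (simp add: has_bochner_integral_iff I_def)
  finally have "M * I t0 \<le> M * (q * I r + y r * rl_kernel (\<alpha> + 1) (t0 - r))"
    using M by (rule mult_left_mono)
  also have "\<dots> = q * (M * I r) + y r * (M * rl_kernel (\<alpha> + 1) (t0 - r))"
    by (simp add: algebra_simps)
  also have "M * I r = rl_kernel \<beta> r - y r"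
    using eq[of r] by simp
  finally have "M * I t0 \<le> rl_kernel \<beta> t0 - q * y r + y r * (M * rl_kernel (\<alpha> + 1) (t0 - r))"
    using q_rl by (simp add: algebra_simps)
  \<comment> \<open>From \<open>y t0 \<le> 0\<close>. Together with the previous estimate it forces
    \<open>q * y r \<le> y r * (M * rl_kernel (\<alpha> + 1) (t0 - r))\<close>, but the right side
    is below \<open>y r / 2 \<le> q * y r\<close>.\<close>
  moreover have "rl_kernel \<beta> t0 \<le> M * I t0"
    using eq[of t0] t0 by simp
  moreover have "y r * (M * rl_kernel (\<alpha> + 1) (t0 - r)) < y r * (1/2)"
    using \<open>0 < y r\<close> e(2)[of "t0 - r"] a r' by (intro mult_strict_left_mono) auto
  moreover have "y r * (1/2) \<le> y r * q"
    using \<open>0 < y r\<close> q_half by (intro mult_left_mono) auto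
  ultimately show False by (simp add: mult_ac)
qed

subsection \<open>Convolution with bounded functions\<close>

lemma integrable_convolution_bounded:
  fixes g h :: "real \<Rightarrow> real"
  assumes g: "integrable lborel g" and h [measurable]: "h \<in> borel_measurable borel"
    and bd: "\<And>s. \<bar>h s\<bar> \<le> B"
  shows "integrable lborel (\<lambda>\<tau>. g (s - \<tau>) * h \<tau>)"
proof -
  have [measurable]: "g \<in> borel_measurable borel"
    using g by (auto dest: borel_measurable_integrable)
  have "0 \<le> B" using bd[of 0] by linarith
  then show ?thesis
    using lborel_integrable_real_affine[OF g, of "-1" s]
    by (intro Bochner_Integration.integrable_bound[where g = "\<lambda>\<tau>. g (s - \<tau>) * h \<tau>"
          and f = "\<lambda>\<tau>. B * g (s - \<tau>)"])
       (auto simp: abs_mult mult.commute[of B] intro!: mult_left_mono bd)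
qed

text \<open>Fubini for a merely bounded \<open>h\<close>: the inner integral of absolute values is
  at most \<open>B\<close> times the L1 norm of \<open>g\<close>, uniformly in \<open>s\<close>, and
  \<open>f\<close> is integrable. A shift of \<open>s\<close> by \<open>\<tau>\<close> then gives
  the right side.\<close>

lemma convolution_assoc:
  fixes f g h :: "real \<Rightarrow> real"
  assumes f: "integrable lborel f" and g: "integrable lborel g"
    and h [measurable]: "h \<in> borel_measurable borel" and bd: "\<And>s. \<bar>h s\<bar> \<le> B"
  shows "(\<integral>s. f (t - s) * (\<integral>\<tau>. g (s - \<tau>) * h \<tau> \<partial>lborel) \<partial>lborel)
    = (\<integral>\<tau>. (\<integral>s. f (t - \<tau> - s) * g s \<partial>lborel) * h \<tau> \<partial>lborel)"
proof -
  have [measurable]: "f \<in> borel_measurable borel" "g \<in> borel_measurable borel"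
    using f g by (auto dest: borel_measurable_integrable)
  have B: "0 \<le> B" using bd[of 0] by linarith
  have g_shift: "integrable lborel (\<lambda>\<tau>. g (s - \<tau>))" for s
    using lborel_integrable_real_affine[OF g, of "-1" s] by simp
  have f_shift: "integrable lborel (\<lambda>s. f (t - s))"
    using lborel_integrable_real_affine[OF f, of "-1" t] by simp
  have inner: "integrable lborel (\<lambda>\<tau>. g (s - \<tau>) * h \<tau>)" for s
    using g h bd by (rule integrable_convolution_bounded)
  have "integrable (lborel \<Otimes>\<^sub>M lborel) (\<lambda>(s, \<tau>). f (t - s) * (g (s - \<tau>) * h \<tau>))"
  proof (rule lborel_pair.Fubini_integrable)
    show "(\<lambda>(s, \<tau>). f (t - s) * (g (s - \<tau>) * h \<tau>)) \<in> borel_measurable (lborel \<Otimes>\<^sub>M lborel)"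
      by measurable
    show "AE s in lborel. integrable lborel (\<lambda>\<tau>. case (s, \<tau>) of (s, \<tau>) \<Rightarrow> f (t - s) * (g (s - \<tau>) * h \<tau>))"
      using inner by simp
    let ?N = "\<lambda>s. \<integral>\<tau>. \<bar>g (s - \<tau>) * h \<tau>\<bar> \<partial>lborel"
    have N: "?N s \<le> B * (\<integral>\<tau>. \<bar>g \<tau>\<bar> \<partial>lborel)" for s
    proof -
      have "?N s \<le> (\<integral>\<tau>. B * \<bar>g (s - \<tau>)\<bar> \<partial>lborel)"
        using g_shift[of s] bd
        by (intro integral_mono integrable_abs[OF inner[of s]])
           (auto simp: abs_mult mult.commute[of B] intro!: mult_left_mono)
      also have "\<dots> = B * (\<integral>\<tau>. \<bar>g \<tau>\<bar> \<partial>lborel)"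
        using lborel_integral_real_affine[of "-1" "\<lambda>\<tau>. \<bar>g \<tau>\<bar>" s] by simp
      finally show ?thesis .
    qed
    have "integrable lborel (\<lambda>s. \<bar>f (t - s)\<bar> * ?N s)"
    proof (rule Bochner_Integration.integrable_bound
        [OF integrable_mult_right[OF f_shift, of "B * (\<integral>\<tau>. \<bar>g \<tau>\<bar> \<partial>lborel)"]])
      show "AE s in lborel. norm (\<bar>f (t - s)\<bar> * ?N s)
          \<le> norm (B * (\<integral>\<tau>. \<bar>g \<tau>\<bar> \<partial>lborel) * f (t - s))"
        using N B by (intro AE_I2)
          (auto simp: abs_mult mult.commute[of _ "\<bar>f _\<bar>"] intro!: mult_left_mono)
    qed measurable
    then show "integrable lborel
        (\<lambda>s. \<integral>\<tau>. norm (case (s, \<tau>) of (s, \<tau>) \<Rightarrow> f (t - s) * (g (s - \<tau>) * h \<tau>)) \<partial>lborel)"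
      by (simp add: abs_mult[of "f _"])
  qed
  from lborel_pair.Fubini_integral[OF this]
  have "(\<integral>s. f (t - s) * (\<integral>\<tau>. g (s - \<tau>) * h \<tau> \<partial>lborel) \<partial>lborel)
    = (\<integral>\<tau>. (\<integral>s. f (t - s) * g (s - \<tau>) * h \<tau> \<partial>lborel) \<partial>lborel)"
    by (simp add: mult.assoc)
  also have "(\<lambda>\<tau>. \<integral>s. f (t - s) * g (s - \<tau>) * h \<tau> \<partial>lborel)
      = (\<lambda>\<tau>. (\<integral>s. f (t - \<tau> - s) * g s \<partial>lborel) * h \<tau>)"
  proof
    fix \<tau>
    show "(\<integral>s. f (t - s) * g (s - \<tau>) * h \<tau> \<partial>lborel) = (\<integral>s. f (t - \<tau> - s) * g s \<partial>lborel) * h \<tau>"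
      using lborel_integral_real_affine[of 1 "\<lambda>s. f (t - s) * g (s - \<tau>)" \<tau>]
      by (simp add: algebra_simps)
  qed
  finally show ?thesis .
qed

text \<open>Makes integrability facts about \<open>ml_kernel\<close> available for
  \<open>rl_kernel\<close>.\<close>

lemma ml_kernel_0: "0 < \<alpha> \<Longrightarrow> 0 < \<beta> \<Longrightarrow> ml_kernel 0 \<alpha> \<beta> = rl_kernel \<beta>"
  using ml_kernel_unfold[of \<alpha> \<beta> 0] by auto

lemma ml_rl_kernel_convolution:
  assumes "0 < \<alpha>" "0 < \<beta>" "0 < \<gamma>"
  shows "has_bochner_integral lborel (\<lambda>s. ml_kernel \<mu> \<alpha> \<beta> (t - s) * rl_kernel \<gamma> s)
    (ml_kernel \<mu> \<alpha> (\<beta> + \<gamma>) t)"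
  using rl_ml_kernel_convolution[OF assms, of t \<mu>]
  by (subst lborel_has_bochner_integral_real_affine_iff[of "-1" _ _ t]) (simp_all add: mult.commute)

text \<open>\<open>rl_kernel 1 (T - s)\<close> is the indicator of \<open>s < T\<close>, so this is
  convolution with index 1.\<close>

lemma integrable_truncated_ml_kernel:
  assumes "0 < \<alpha>" "0 < \<beta>"
  shows "integrable lborel (\<lambda>s. rl_kernel 1 (T - s) * ml_kernel \<mu> \<alpha> \<beta> s)"
  using rl_ml_kernel_convolution[OF assms, of 1] by (simp add: has_bochner_integral_iff)

lemma continuous_on_Icc_indicator:
  fixes \<phi> :: "real \<Rightarrow> real"
  assumes "continuous_on {a..b} \<phi>"
  obtains B where "(\<lambda>s. indicator {a..b} s * \<phi> s) \<in> borel_measurable borel"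
    "\<And>s. \<bar>indicator {a..b} s * \<phi> s\<bar> \<le> B"
proof -
  have "bounded (\<phi> ` {a..b})"
    using assms by (intro compact_imp_bounded compact_continuous_image) auto
  then obtain B where B: "0 < B" "\<And>s. s \<in> {a..b} \<Longrightarrow> \<bar>\<phi> s\<bar> \<le> B"
    by (auto simp: bounded_pos)
  show ?thesis
  proof
    show "(\<lambda>s. indicator {a..b} s * \<phi> s) \<in> borel_measurable borel"
      using borel_measurable_continuous_on_indicator[OF _ assms] by simp
    show "\<bar>indicator {a..b} s * \<phi> s\<bar> \<le> B" for s
      using B by (auto simp: indicator_def)
  qed
qed

lemma integrable_ml_kernel_convolution:
  assumes "0 < \<alpha>" "0 < \<beta>" "continuous_on {0..t} \<phi>"
  shows "integrable lborel (\<lambda>s. ml_kernel \<mu> \<alpha> \<beta> (t - s) * (indicator {0..t} s * \<phi> s))"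
proof -
  obtain B where "(\<lambda>s. indicator {0..t} s * \<phi> s) \<in> borel_measurable borel"
    "\<And>s. \<bar>indicator {0..t} s * \<phi> s\<bar> \<le> B"
    using continuous_on_Icc_indicator[OF assms(3)] by blast
  \<comment> \<open>The cut-off is \<open>t + 1\<close>, not \<open>t\<close>:
    \<open>rl_kernel 1\<close> is 0 at 0, and at \<open>s = 0\<close> the kernel value at
    \<open>t\<close> must survive.\<close>
  from integrable_convolution_bounded[OF integrable_truncated_ml_kernel[OF assms(1,2)] this,
      of "t + 1" t \<mu>]
  show ?thesis
    by (rule Bochner_Integration.integrable_cong[THEN iffD1, rotated 2])
       (auto simp: indicator_def rl_kernel_def)
qed

subsection \<open>Linear Volterra equations\<close>

text \<open>Convolving \<open>u - u\<^sub>0 = k * g\<close> with the resolvent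
  \<open>r \<alpha>\<close> gives \<open>r (\<alpha> + \<alpha>) * g\<close>, where \<open>*\<close>
  is convolution and \<open>k\<close> is \<open>rl_kernel \<alpha>\<close>. As
  \<open>r \<alpha> + M r (\<alpha> + \<alpha>) = k\<close>, the terms in \<open>g\<close> collapse
  to \<open>u - u\<^sub>0\<close>; the constant part integrates to
  \<open>u\<^sub>0 (1 - r 1)\<close>.\<close>

theorem volterra_variation_of_constants:
  fixes u g :: "real \<Rightarrow> real"
  assumes \<alpha>: "0 < \<alpha>" and t: "0 < t"
    and u: "continuous_on {0..t} u" and g: "continuous_on {0..t} g"
    and eq: "\<And>x. x \<in> {0..t} \<Longrightarrow>
      u x = u\<^sub>0 + (LINT s:{0..x}|lborel. rl_kernel \<alpha> (x - s) * g s)"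
  shows "u t = u\<^sub>0 * ml_kernel (- M) \<alpha> 1 t
    + (LINT s:{0..t}|lborel. ml_kernel (- M) \<alpha> \<alpha> (t - s) * (g s + M * u s))"
proof -
  define r where "r = ml_kernel (- M) \<alpha>"
  define ind :: "real \<Rightarrow> real" where "ind = indicator {0..t}"
  \<comment> \<open>Cutting the kernels off at \<open>t + 1\<close> makes them integrable without changing the convolutions on \<open>[0, t]\<close>.\<close>
  define R where "R s = rl_kernel 1 (t + 1 - s) * r \<alpha> s" for s
  define K where "K s = rl_kernel 1 (t + 1 - s) * rl_kernel \<alpha> s" for s
  obtain B where G: "(\<lambda>s. ind s * g s) \<in> borel_measurable borel" "\<And>s. \<bar>ind s * g s\<bar> \<le> B"
    using continuous_on_Icc_indicator[OF g] unfolding ind_def by blast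
  have R_int: "integrable lborel R" and K_int: "integrable lborel K"
    using integrable_truncated_ml_kernel[of \<alpha> \<alpha> "t + 1" "- M"]
      integrable_truncated_ml_kernel[of \<alpha> \<alpha> "t + 1" 0] \<alpha>
    by (simp_all add: R_def [abs_def] K_def [abs_def] r_def ml_kernel_0)
  have int: "integrable lborel (\<lambda>s. r \<beta> (t - s) * (ind s * \<phi> s))"
    if "0 < \<beta>" "continuous_on {0..t} \<phi>" for \<beta> \<phi>
    unfolding r_def ind_def using \<alpha> that by (rule integrable_ml_kernel_convolution)
  \<comment> \<open>The kernel vanishes for \<open>s > x\<close>, so one cut-off at \<open>t\<close>
    serves all \<open>x\<close>.\<close>
  have eq': "u x - u\<^sub>0 = (\<integral>s. rl_kernel \<alpha> (x - s) * (ind s * g s) \<partial>lborel)" if "x \<in> {0..t}" for x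
  proof -
    have "(LINT s:{0..x}|lborel. rl_kernel \<alpha> (x - s) * g s)
        = (\<integral>s. rl_kernel \<alpha> (x - s) * (ind s * g s) \<partial>lborel)"
      unfolding set_lebesgue_integral_def
      by (rule Bochner_Integration.integral_cong)
         (use that in \<open>auto simp: ind_def indicator_def rl_kernel_def\<close>)
    with eq[OF that] show ?thesis by simp
  qed
  have "(\<integral>s. r \<alpha> (t - s) * (ind s * (u s - u\<^sub>0)) \<partial>lborel)
      = (\<integral>s. R (t - s) * (\<integral>\<tau>. K (s - \<tau>) * (ind \<tau> * g \<tau>) \<partial>lborel) \<partial>lborel)"
  proof (rule Bochner_Integration.integral_cong[OF refl])
    fix s
    consider "s < 0" | "s \<in> {0..t}" | "t < s" by fastforce
    then show "r \<alpha> (t - s) * (ind s * (u s - u\<^sub>0))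
        = R (t - s) * (\<integral>\<tau>. K (s - \<tau>) * (ind \<tau> * g \<tau>) \<partial>lborel)"
    proof cases
      case 1
      then have "(\<lambda>\<tau>. K (s - \<tau>) * (ind \<tau> * g \<tau>)) = (\<lambda>_. 0)"
        by (auto simp: K_def ind_def indicator_def rl_kernel_def)
      with 1 show ?thesis by (simp add: ind_def)
    next
      case 2
      then have "(\<lambda>\<tau>. K (s - \<tau>) * (ind \<tau> * g \<tau>)) = (\<lambda>\<tau>. rl_kernel \<alpha> (s - \<tau>) * (ind \<tau> * g \<tau>))"
        by (auto simp: K_def ind_def indicator_def rl_kernel_def)
      with eq'[OF 2] 2 show ?thesis by (simp add: R_def ind_def rl_kernel_def)
    next
      case 3
      then show ?thesis by (simp add: R_def r_def ml_kernel_nonpos_arg)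
    qed
  qed
  also have "\<dots> = (\<integral>\<tau>. (\<integral>s. R (t - \<tau> - s) * K s \<partial>lborel) * (ind \<tau> * g \<tau>) \<partial>lborel)"
    by (rule convolution_assoc[OF R_int K_int G])
  also have "\<dots> = (\<integral>\<tau>. r (\<alpha> + \<alpha>) (t - \<tau>) * (ind \<tau> * g \<tau>) \<partial>lborel)"
  proof (rule Bochner_Integration.integral_cong[OF refl])
    fix \<tau>
    show "(\<integral>s. R (t - \<tau> - s) * K s \<partial>lborel) * (ind \<tau> * g \<tau>)
        = r (\<alpha> + \<alpha>) (t - \<tau>) * (ind \<tau> * g \<tau>)"
    proof (cases "\<tau> \<in> {0..t}")
      case True
      have "R (t - \<tau> - s) * K s = r \<alpha> (t - \<tau> - s) * rl_kernel \<alpha> s" for s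
      proof (cases "0 < s \<and> s < t - \<tau>")
        case False
        then show ?thesis
          by (auto simp: R_def K_def r_def rl_kernel_def ml_kernel_nonpos_arg)
      qed (use True in \<open>auto simp: R_def K_def rl_kernel_def\<close>)
      then show ?thesis
        using ml_rl_kernel_convolution[OF \<alpha> \<alpha> \<alpha>, of "- M" "t - \<tau>"]
        by (simp add: has_bochner_integral_iff r_def)
    qed (simp add: ind_def)
  qed
  finally have assoc: "(\<integral>s. r \<alpha> (t - s) * (ind s * (u s - u\<^sub>0)) \<partial>lborel)
      = (\<integral>s. r (\<alpha> + \<alpha>) (t - s) * (ind s * g s) \<partial>lborel)" .
  have one: "(\<integral>s. r \<alpha> (t - s) * (ind s * 1) \<partial>lborel) = r (\<alpha> + 1) t"
  proof -
    have "(\<integral>s. r \<alpha> (t - s) * (ind s * 1) \<partial>lborel) = (\<integral>s. r \<alpha> (t - s) * rl_kernel 1 s \<partial>lborel)"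
    proof (rule integral_cong_AE)
      show "AE s in lborel. r \<alpha> (t - s) * (ind s * 1) = r \<alpha> (t - s) * rl_kernel 1 s"
        using AE_lborel_singleton[of 0]
        by eventually_elim (auto simp: ind_def indicator_def rl_kernel_def r_def ml_kernel_nonpos_arg)
    qed (simp_all add: r_def ind_def)
    then show ?thesis
      using ml_rl_kernel_convolution[OF \<alpha> \<alpha>, of 1 "- M" t] by (simp add: has_bochner_integral_iff r_def)
  qed
  \<comment> \<open>Splits \<open>u\<close> into \<open>u - u\<^sub>0\<close>, handled by
    \<open>assoc\<close>, and the constant, handled by \<open>one\<close>.\<close>
  have "(LINT s:{0..t}|lborel. r \<alpha> (t - s) * (g s + M * u s))
      = (\<integral>s. (r \<alpha> (t - s) * (ind s * g s) + M * (r \<alpha> (t - s) * (ind s * (u s - u\<^sub>0))))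
          + M * u\<^sub>0 * (r \<alpha> (t - s) * (ind s * 1)) \<partial>lborel)"
    unfolding set_lebesgue_integral_def
    by (rule Bochner_Integration.integral_cong) (auto simp: ind_def indicator_def algebra_simps)
  also have "\<dots> = (\<integral>s. r \<alpha> (t - s) * (ind s * g s) \<partial>lborel)
      + M * (\<integral>s. r \<alpha> (t - s) * (ind s * (u s - u\<^sub>0)) \<partial>lborel)
      + M * u\<^sub>0 * (\<integral>s. r \<alpha> (t - s) * (ind s * 1) \<partial>lborel)"
    using int[OF \<alpha> g] int[OF \<alpha>, of "\<lambda>s. u s - u\<^sub>0"] int[OF \<alpha>, of "\<lambda>_. 1"] u
    by (simp add: continuous_on_diff)
  also have "\<dots> = (\<integral>s. r \<alpha> (t - s) * (ind s * g s) + M * (r (\<alpha> + \<alpha>) (t - s) * (ind s * g s)) \<partial>lborel)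
      + M * u\<^sub>0 * r (\<alpha> + 1) t"
    unfolding assoc one using int[OF \<alpha> g] int[of "\<alpha> + \<alpha>", OF _ g] \<alpha> by simp
  also have "(\<lambda>s. r \<alpha> (t - s) * (ind s * g s) + M * (r (\<alpha> + \<alpha>) (t - s) * (ind s * g s)))
      = (\<lambda>s. rl_kernel \<alpha> (t - s) * (ind s * g s))"
    unfolding r_def ml_kernel_unfold[OF \<alpha> \<alpha>] by (auto simp: algebra_simps)
  also have "(\<integral>s. rl_kernel \<alpha> (t - s) * (ind s * g s) \<partial>lborel) = u t - u\<^sub>0"
    using eq'[of t] t by simp
  also have "M * u\<^sub>0 * r (\<alpha> + 1) t = u\<^sub>0 * (1 - r 1 t)"
  proof -
    have "r 1 t = 1 - M * r (\<alpha> + 1) t"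
      using ml_kernel_unfold[OF \<alpha>, of 1 "- M" t] t by (simp add: r_def rl_kernel_def add.commute)
    then show ?thesis by simp
  qed
  finally show ?thesis by (simp add: r_def algebra_simps)
qed

section \<open>Lower bounds by the first-zero argument\<close>

lemma volterra_lower_bound_pos:
  fixes u g :: "real \<Rightarrow> real"
  assumes \<alpha>: "0 < \<alpha>" "\<alpha> \<le> 1" and t: "0 < t" and M: "0 \<le> M"
    and u: "continuous_on {0..t} u" and g: "continuous_on {0..t} g"
    and bound: "\<And>s. s \<in> {0..t} \<Longrightarrow> \<bar>g s\<bar> \<le> M * \<bar>u s\<bar>"
    and eq: "\<And>x. x \<in> {0..t} \<Longrightarrow>
      u x = u 0 + (LINT s:{0..x}|lborel. rl_kernel \<alpha> (x - s) * g s)"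
    and u0: "0 < u 0"
  shows "u 0 * ml_kernel (- M) \<alpha> 1 t \<le> u t"
proof -
  \<comment> \<open>Nonnegativity is asked only strictly before \<open>x\<close>, so that this
    applies at the first zero itself.\<close>
  have lower: "u 0 * ml_kernel (- M) \<alpha> 1 x \<le> u x"
    if x: "0 < x" "x \<le> t" and nonneg: "\<And>s. 0 \<le> s \<Longrightarrow> s < x \<Longrightarrow> 0 \<le> u s" for x
  proof -
    have "u x = u 0 * ml_kernel (- M) \<alpha> 1 x
        + (LINT s:{0..x}|lborel. ml_kernel (- M) \<alpha> \<alpha> (x - s) * (g s + M * u s))"
    proof (rule volterra_variation_of_constants)
      show "continuous_on {0..x} u" "continuous_on {0..x} g"
        using x by (auto intro: continuous_on_subset[OF u] continuous_on_subset[OF g])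
      show "u z = u 0 + (LINT s:{0..z}|lborel. rl_kernel \<alpha> (z - s) * g s)" if "z \<in> {0..x}" for z
        using that x by (intro eq) auto
    qed (use x \<alpha> in auto)
    moreover have "0 \<le> (LINT s:{0..x}|lborel. ml_kernel (- M) \<alpha> \<alpha> (x - s) * (g s + M * u s))"
      unfolding set_lebesgue_integral_def
    proof (rule Bochner_Integration.integral_nonneg)
      fix s
      show "0 \<le> indicator {0..x} s *\<^sub>R (ml_kernel (- M) \<alpha> \<alpha> (x - s) * (g s + M * u s))"
      proof (cases "0 \<le> s \<and> s < x")
        case True
        then have "0 \<le> g s + M * u s"
          using bound[of s] nonneg[of s] x by auto
        moreover have "0 < ml_kernel (- M) \<alpha> \<alpha> (x - s)"
          by (rule ml_kernel_pos) (use \<alpha> M True in auto)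
        ultimately show ?thesis by simp
      qed (auto simp: indicator_def ml_kernel_nonpos_arg)
    qed
    ultimately show ?thesis by simp
  qed
  have pos: "0 < u s" if "s \<in> {0..t}" for s
  proof (rule ccontr)
    assume "\<not> 0 < u s"
    let ?Z = "{0..t} \<inter> u -` {..0}"
    have "closed ?Z"
      by (intro continuous_closed_preimage u) auto
    moreover have "bounded ?Z"
      by (rule bounded_subset[OF bounded_closed_interval[of 0 t]]) auto
    ultimately have "compact ?Z" by (simp add: compact_eq_bounded_closed)
    moreover have "s \<in> ?Z" using that \<open>\<not> 0 < u s\<close> by simp
    ultimately obtain z where z: "z \<in> ?Z" and least: "\<And>x. x \<in> ?Z \<Longrightarrow> z \<le> x"
      using compact_attains_inf[of ?Z] by blast
    have "z \<noteq> 0" using z u0 by auto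
    with z have z': "0 < z" "z \<le> t" "u z \<le> 0" by auto
    have "0 \<le> u x" if "0 \<le> x" "x < z" for x
      using least[of x] that z' by force
    then have "u 0 * ml_kernel (- M) \<alpha> 1 z \<le> u z"
      using z' by (intro lower) auto
    moreover have "0 < u 0 * ml_kernel (- M) \<alpha> 1 z"
      using u0 z' \<alpha> M by (intro mult_pos_pos ml_kernel_pos) auto
    ultimately show False using z' by simp
  qed
  show ?thesis
    by (rule lower) (use t pos in \<open>auto intro: less_imp_le\<close>)
qed

text \<open>The pair \<open>- u\<close>, \<open>- g\<close> satisfies the same hypotheses, which
  reduces a negative start to a positive one; for \<open>u 0 = 0\<close> the left side is 0.\<close>

theorem volterra_lower_bound:
  fixes u g :: "real \<Rightarrow> real"
  assumes \<alpha>: "0 < \<alpha>" "\<alpha> \<le> 1" and t: "0 < t" and M: "0 \<le> M"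
    and u: "continuous_on {0..t} u" and g: "continuous_on {0..t} g"
    and bound: "\<And>s. s \<in> {0..t} \<Longrightarrow> \<bar>g s\<bar> \<le> M * \<bar>u s\<bar>"
    and eq: "\<And>x. x \<in> {0..t} \<Longrightarrow>
      u x = u 0 + (LINT s:{0..x}|lborel. rl_kernel \<alpha> (x - s) * g s)"
  shows "\<bar>u 0\<bar> * ml_kernel (- M) \<alpha> 1 t \<le> \<bar>u t\<bar>"
proof -
  consider "0 < u 0" | "u 0 < 0" | "u 0 = 0" by linarith
  then show ?thesis
  proof cases
    case 1
    with volterra_lower_bound_pos[OF assms] show ?thesis by simp
  next
    case 2
    have "- u x = - u 0 + (LINT s:{0..x}|lborel. rl_kernel \<alpha> (x - s) * - g s)"
      if "x \<in> {0..t}" for x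
      by (subst eq[OF that]) (simp add: set_lebesgue_integral_def)
    then have "- u 0 * ml_kernel (- M) \<alpha> 1 t \<le> - u t"
      by (rule volterra_lower_bound_pos[of \<alpha> t M "\<lambda>x. - u x" "\<lambda>x. - g x", rotated -2])
         (use \<alpha> t M u g bound 2 in \<open>auto intro: continuous_on_minus\<close>)
    with 2 show ?thesis by simp
  qed simp
qed

section \<open>Application to solutions of the Caputo equation\<close>

lemma continuous_on_superposition:
  assumes "continuous_on (J \<times> UNIV) (\<lambda>(s, y). f s y)" "S \<subseteq> J" "continuous_on S x"
  shows "continuous_on S (\<lambda>s. f s (x s))"
proof -
  have "continuous_on S (\<lambda>s. (s, x s))"
    using assms(3) by (intro continuous_intros)
  then show ?thesis
    using continuous_on_compose2[OF assms(1), of S "\<lambda>s. (s, x s)"] assms(2) by auto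
qed

text \<open>Each solution contributes an integrable convolution, so the two integrals may be
  subtracted under one sign.\<close>

lemma caputo_solution_diff:
  assumes \<alpha>: "0 < \<alpha>" and J: "{0..t} \<subseteq> J" and t: "0 \<le> t"
    and f: "continuous_on (J \<times> UNIV) (\<lambda>(s, y). f s y)"
    and sol: "caputo_solution \<alpha> f J x1" "caputo_solution \<alpha> f J x2"
  shows "x2 t - x1 t = x2 0 - x1 0
    + (LINT s:{0..t}|lborel. rl_kernel \<alpha> (t - s) * (f s (x2 s) - f s (x1 s)))"
proof -
  have sol_rl: "integrable lborel (\<lambda>s. rl_kernel \<alpha> (t - s) * (indicator {0..t} s * f s (x s)))
      \<and> x t = x 0 + (\<integral>s. rl_kernel \<alpha> (t - s) * (indicator {0..t} s * f s (x s)) \<partial>lborel)"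
    if "caputo_solution \<alpha> f J x" for x
  proof
    have "continuous_on {0..t} x"
      using that J by (auto simp: caputo_solution_def intro: continuous_on_subset)
    then have "continuous_on {0..t} (\<lambda>s. f s (x s))"
      by (rule continuous_on_superposition[OF f J])
    from integrable_ml_kernel_convolution[OF \<alpha> \<alpha> this, of 0]
    show "integrable lborel (\<lambda>s. rl_kernel \<alpha> (t - s) * (indicator {0..t} s * f s (x s)))"
      using \<alpha> by (simp add: ml_kernel_0)
    have "(1 / Gamma \<alpha>) * (LINT s:{0..t}|lborel. (t - s) powr (\<alpha> - 1) * f s (x s))
        = (LINT s:{0..t}|lborel. (1 / Gamma \<alpha>) * ((t - s) powr (\<alpha> - 1) * f s (x s)))"
      by simp
    \<comment> \<open>The integrands agree also at \<open>s = t\<close>, where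
      \<open>0 powr a = 0\<close> matches the value of \<open>rl_kernel\<close> at 0.\<close>
    also have "\<dots> = (\<integral>s. rl_kernel \<alpha> (t - s) * (indicator {0..t} s * f s (x s)) \<partial>lborel)"
      unfolding set_lebesgue_integral_def
      by (rule Bochner_Integration.integral_cong) (auto simp: indicator_def rl_kernel_def)
    finally show "x t = x 0 + (\<integral>s. rl_kernel \<alpha> (t - s) * (indicator {0..t} s * f s (x s)) \<partial>lborel)"
      using that J t by (auto simp: caputo_solution_def)
  qed
  have "(LINT s:{0..t}|lborel. rl_kernel \<alpha> (t - s) * (f s (x2 s) - f s (x1 s)))
      = (\<integral>s. rl_kernel \<alpha> (t - s) * (indicator {0..t} s * f s (x2 s))
          - rl_kernel \<alpha> (t - s) * (indicator {0..t} s * f s (x1 s)) \<partial>lborel)"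
    unfolding set_lebesgue_integral_def
    by (rule Bochner_Integration.integral_cong) (auto simp: algebra_simps)
  with sol_rl[OF sol(1)] sol_rl[OF sol(2)] show ?thesis
    by simp
qed

theorem mainTheorem2:
  fixes \<alpha> T :: real and J :: "real set" and f :: "real \<Rightarrow> real \<Rightarrow> real"
    and L x1 x2 :: "real \<Rightarrow> real" and t :: real
  assumes "0 < \<alpha>" "\<alpha> < 1"
    and "(T > 0 \<and> J = {0..T}) \<or> J = {0..}"
    and "continuous_on (J \<times> UNIV) (\<lambda>(s, y). f s y)"
    and "continuous_on J L" "\<forall>s\<in>J. L s \<ge> 0"
    and "\<forall>s\<in>J. \<forall>y z. \<bar>f s y - f s z\<bar> \<le> L s * \<bar>y - z\<bar>"
    and "caputo_solution \<alpha> f J x1" "caputo_solution \<alpha> f J x2"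
    and "t \<in> J"
  shows "\<bar>x2 t - x1 t\<bar> \<ge>
    \<bar>x2 0 - x1 0\<bar> * mittag_leffler \<alpha> (- (Sup (L ` {0..t})) * t powr \<alpha>)"
proof (cases "t = 0")
  case True
  \<comment> \<open>Treated separately, since \<open>ml_kernel\<close> is 0 at \<open>t = 0\<close>
    whereas the Mittag-Leffler function is 1 there.\<close>
  have "mittag_leffler \<alpha> 0 = 1"
    using powser_zero[of "\<lambda>n. inverse (Gamma (\<alpha> * real n + 1))"]
    by (simp add: mittag_leffler_def field_simps)
  with True show ?thesis by simp
next
  case False
  have t: "0 < t" and J: "{0..t} \<subseteq> J"
    using assms(3,10) False by auto
  define M where "M = Sup (L ` {0..t})"
  have "compact (L ` {0..t})"
    using continuous_on_subset[OF assms(5) J] by (intro compact_continuous_image) auto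
  then have "bdd_above (L ` {0..t})"
    by (intro bounded_imp_bdd_above compact_imp_bounded)
  then have LM: "L s \<le> M" if "s \<in> {0..t}" for s
    unfolding M_def using that by (intro cSUP_upper)
  have "0 \<le> M"
    using LM[of 0] assms(6) J t by force
  have x12: "continuous_on {0..t} x1" "continuous_on {0..t} x2"
    using assms(8,9) J by (auto simp: caputo_solution_def intro: continuous_on_subset)
  have fx: "continuous_on {0..t} (\<lambda>s. f s (x s))" if "continuous_on {0..t} x" for x
    using that by (rule continuous_on_superposition[OF assms(4) J])
  have "\<bar>x2 0 - x1 0\<bar> * ml_kernel (- M) \<alpha> 1 t \<le> \<bar>x2 t - x1 t\<bar>"
  proof (rule volterra_lower_bound[where u = "\<lambda>s. x2 s - x1 s" and g = "\<lambda>s. f s (x2 s) - f s (x1 s)"])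
    show "\<bar>f s (x2 s) - f s (x1 s)\<bar> \<le> M * \<bar>x2 s - x1 s\<bar>" if "s \<in> {0..t}" for s
    proof -
      have "\<bar>f s (x2 s) - f s (x1 s)\<bar> \<le> L s * \<bar>x2 s - x1 s\<bar>"
        using assms(7) J that by blast
      also have "\<dots> \<le> M * \<bar>x2 s - x1 s\<bar>"
        using LM[OF that] by (rule mult_right_mono) simp
      finally show ?thesis .
    qed
    show "x2 x - x1 x = x2 0 - x1 0
        + (LINT s:{0..x}|lborel. rl_kernel \<alpha> (x - s) * (f s (x2 s) - f s (x1 s)))"
      if "x \<in> {0..t}" for x
      by (rule caputo_solution_diff[OF assms(1) _ _ assms(4,8,9)]) (use J that in auto)
  qed (use assms(1,2) t \<open>0 \<le> M\<close> x12 fx in \<open>auto intro!: continuous_on_diff\<close>)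
  then show ?thesis
    using mittag_leffler_eq_ml_kernel[OF t assms(1), of "- M"] by (simp add: M_def)
qed

end
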